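(* For every integer $n\ge 4$, the average number $\mathbb{E}(C^{\mathrm{cv}}_n)$ of comparisons made by the dual-pivot quicksort algorithm ``Clairvoyant'' (with oracle) on a uniformly random permutation of $n$ distinct elements is $$\mathbb{E}(C^{\mathrm{cv}}_n)=\frac{9}{5}nH_n+\frac{1}{5}nH^{\mathrm{alt}}_n-\frac{89}{25}n+\frac{77}{40}H_n+\frac{3}{40}H^{\mathrm{alt}}_n+\frac{67}{800}-\frac{(-1)^n}{10}+r_n,$$ where $$r_n=\frac{[n\text{ even}]}{320}\Bigl(\frac{1}{n-3}+\frac{3}{n-1}\Bigr)-\frac{[n\text{ odd}]}{320}\Bigl(\frac{3}{n-2}+\frac{1}{n}\Bigr).$$
   Context: Notation: $[\mathit{expr}]$ is $1$ if $\mathit{expr}$ is true and $0$ otherwise; a term multiplied by a bracket equal to $0$ is taken to be $0$. $H_n=\sum_{m=1}^n \frac1m$ and $H^{\mathrm{alt}}_n=\sum_{m=1}^n\frac{(-1)^m}{m}$. Dual-pivot quicksort: the input is a sequence $(a_1,\dots,a_n)$ of $n$ distinct numbers in uniformly random order (w.l.o.g. a uniformly random permutation of $\{1,\dots,n\}$). If $n\le 1$, nothing is done (0 comparisons). If $n\ge2$, one comparison of $a_1$ and $a_n$ determines the pivots $p=\min(a_1,a_n)$ and $q=\max(a_1,a_n)$. Then the remaining $n-2$ elements $a_2,\dots,a_{n-1}$ are classified one after another as small ($<p$), medium (between $p$ and $q$) or large ($>q$). Each element is compared first with one of the two pivots, as prescribed by the classification strategy, and is then compared with the other pivot exactly if its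 class is not yet determined (so a small element costs 1 comparison if compared with $p$ first and 2 if compared with $q$ first; a large element costs 1 if compared with $q$ first and 2 if compared with $p$ first; a medium element always costs 2). Finally the algorithm is applied recursively, with the same strategy, to the group of small, the group of medium and the group of large elements (the inputs of the recursive calls are again in uniformly random order, e.g. if the original relative order is kept). Only comparisons between elements are counted. Strategy ``Clairvoyant'': let $s=p-1$ and $\ell=n-q$ be the total numbers of small and large elements for an input that is a permutation of $\{1,\dots,n\}$ (given by an oracle at no cost), and let $s_i$, $\ell_i$ be the numbers of elements classified as small, respectively large, among the first $i$ classified elements ($s_0=\ell_0=0$). When classifying the $i$th element, $1\le i\le n-2$: if $s-s_{i-1}\ge \ell-\ell_{i-1}$, compare with $p$ first, otherwise compare with $q$ first. $C^{\mathrm{cv}}_n$ is the random variable giving the total number of comparisons (including all recursive calls) when sorting $n$ elements with strategy ``Clairvoyant''. *)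

theory Defs
  imports
    "HOL-Probability.Probability"
    "HOL-Combinatorics.Multiset_Permutations"
begin

text \<open>
  A strategy decides, from the numbers of elements already classified as small and as large,
  whether the next element is compared with the smaller pivot first (\<^const>\<open>True\<close>) or with
  the larger pivot first (\<^const>\<open>False\<close>).
\<close>

type_synonym strategy = "nat \<Rightarrow> nat \<Rightarrow> bool"

fun element_cost :: "bool \<Rightarrow> 'a::linorder \<Rightarrow> 'a \<Rightarrow> 'a \<Rightarrow> nat" where
  "element_cost p_first p q x =
     (if p_first then (if x < p then 1 else 2) else (if x > q then 1 else 2))"

text \<open>
  The arguments \<open>i\<close> and \<open>j\<close> are the numbers of small and of large elements
  among those classified so far.
\<close>

fun classification_cost ::
  "strategy \<Rightarrow> 'a::linorder \<Rightarrow> 'a \<Rightarrow> nat \<Rightarrow> nat \<Rightarrow> 'a list \<Rightarrow> nat" where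
  "classification_cost \<sigma> p q i j [] = 0"
| "classification_cost \<sigma> p q i j (x # xs) =
     element_cost (\<sigma> i j) p q x +
     classification_cost \<sigma> p q
       (if x < p then i + 1 else i) (if x > q then j + 1 else j) xs"

text \<open>
  The parameters \<open>s\<close> and \<open>l\<close> are the oracle values. The differences are taken in the integers
  to avoid truncated subtraction.
\<close>

definition clairvoyant :: "nat \<Rightarrow> nat \<Rightarrow> strategy" where
  "clairvoyant s l i j \<longleftrightarrow> int s - int i \<ge> int l - int j"

text \<open>
  The oracle values are obtained by counting, since the inputs of the recursive calls are not
  permutations of an initial segment of the positive integers; for a permutation of
  \<open>{1..n}\<close> with pivots \<open>p < q\<close> they are \<open>p - 1\<close> and \<open>n - q\<close>.
  The value is only meaningful for lists of distinct elements.
\<close>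

function cv_comparisons :: "'a::linorder list \<Rightarrow> nat" where
  "cv_comparisons xs =
     (if length xs \<le> 1 then 0
      else
        let p = min (hd xs) (last xs);
            q = max (hd xs) (last xs);
            ys = butlast (tl xs);
            smalls = filter (\<lambda>x. x < p) ys;
            mediums = filter (\<lambda>x. p < x \<and> x < q) ys;
            larges = filter (\<lambda>x. x > q) ys
        in 1 + classification_cost (clairvoyant (length smalls) (length larges)) p q 0 0 ys
             + cv_comparisons smalls + cv_comparisons mediums + cv_comparisons larges)"
  by pat_completeness auto
termination
proof (relation "Wellfounded.measure length", goal_cases)
  case 1
  show ?case by simp
qed (auto intro!: le_less_trans[OF length_filter_le])

declare cv_comparisons.simps [simp del]

definition expected_cv_comparisons :: "nat \<Rightarrow> real" where
  "expected_cv_comparisons n =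
     measure_pmf.expectation (pmf_of_set (permutations_of_set {1..n}))
       (\<lambda>xs. real (cv_comparisons xs))"

definition alt_harm :: "nat \<Rightarrow> real" where
  "alt_harm n = (\<Sum>m=1..n. (-1) ^ m / real m)"

definition cv_remainder :: "nat \<Rightarrow> real" where
  "cv_remainder n =
     of_bool (even n) / 320 * (1 / (real n - 3) + 3 / (real n - 1))
     - of_bool (odd n) / 320 * (3 / (real n - 2) + 1 / real n)"

end

theory Submission
  imports Defs
begin

text \<open>
  Classifying \<open>s\<close> small, \<open>m\<close> medium and \<open>l\<close> large elements costs \<open>s + 2 m + l\<close> comparisons plus one
  for each small or large element that is compared with the wrong pivot first. Read backwards, the
  small and large elements form a uniformly random lattice path from the origin to \<open>(s, l)\<close>, and
  the expected number of wrong first comparisons is \<open>min s l\<close> minus half of the expected number of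
  returns to the diagonal. Summed over \<open>s + l = N\<close>, the expected number of visits to the
  diagonal collapses to \<open>N + 1\<close> times \<open>1 + 1/3 + 1/5 + \<dots>\<close>, which brings in the alternating
  harmonic numbers. Taking second differences of the quicksort recurrence gives a three-term
  recurrence, which the closed form satisfies.
\<close>

section \<open>Averages over the permutations of a finite set\<close>

text \<open>The uniform expectation as a plain finite sum, so that linearity and congruence need no
  integrability conditions.\<close>

definition perm_avg :: "'a set \<Rightarrow> ('a list \<Rightarrow> real) \<Rightarrow> real" where
  "perm_avg A f = (\<Sum>xs\<in>permutations_of_set A. f xs) / fact (card A)"

lemma perm_avg_eq_expectation:
  assumes "finite A"
  shows "perm_avg A f = measure_pmf.expectation (pmf_of_set (permutations_of_set A)) f"
  using assms by (simp add: perm_avg_def integral_pmf_of_set)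

lemma perm_avg_add: "perm_avg A (\<lambda>xs. f xs + g xs) = perm_avg A f + perm_avg A g"
  by (simp add: perm_avg_def sum.distrib add_divide_distrib)

lemma perm_avg_const: "finite A \<Longrightarrow> perm_avg A (\<lambda>_. c) = c"
  by (simp add: perm_avg_def)

lemma perm_avg_cong:
  "(\<And>xs. xs \<in> permutations_of_set A \<Longrightarrow> f xs = g xs) \<Longrightarrow> perm_avg A f = perm_avg A g"
  by (simp add: perm_avg_def)

text \<open>The head of a uniform permutation is uniform on \<open>A\<close>; given the head, the
  tail is a uniform permutation of the rest.\<close>

lemma perm_avg_Cons:
  assumes "finite A" "A \<noteq> {}"
  shows "perm_avg A f = (\<Sum>x\<in>A. perm_avg (A - {x}) (\<lambda>xs. f (x # xs))) / card A"
proof -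
  have "perm_avg A f = (\<Sum>x\<in>A. perm_avg (A - {x}) (\<lambda>xs. f (x # xs)) / card A)"
    using assms
    by (simp add: perm_avg_eq_expectation random_permutation_of_set pmf_expectation_bind_pmf_of_set
        bind_return_pmf' map_pmf_def[symmetric] divide_inverse mult.commute)
  then show ?thesis by (simp add: sum_divide_distrib)
qed

lemma perm_avg_rev: "perm_avg A (\<lambda>xs. f (rev xs)) = perm_avg A f"
  unfolding perm_avg_def
  by (intro arg_cong2[where f = "(/)"] refl
      sum.reindex_bij_witness[where i = rev and j = rev])
     (auto simp: permutations_of_set_def)

lemma perm_avg_snoc:
  assumes "finite A" "A \<noteq> {}"
  shows "perm_avg A f = (\<Sum>x\<in>A. perm_avg (A - {x}) (\<lambda>xs. f (xs @ [x]))) / card A"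
proof -
  have "perm_avg A f = perm_avg A (\<lambda>xs. f (rev xs))" by (simp add: perm_avg_rev)
  also have "\<dots> = (\<Sum>x\<in>A. perm_avg (A - {x}) (\<lambda>xs. f (rev xs @ [x]))) / card A"
    by (subst perm_avg_Cons[OF assms]) simp
  also have "\<dots> = (\<Sum>x\<in>A. perm_avg (A - {x}) (\<lambda>xs. f (xs @ [x]))) / card A"
    by (subst perm_avg_rev[where f = "\<lambda>xs. f (xs @ [_])"]) (rule refl)
  finally show ?thesis .
qed

text \<open>Conditions on the head and then on the last element, since these two become the pivots;
  the list between them stays uniformly random.\<close>

lemma perm_avg_ends:
  assumes "card A \<ge> 2"
  shows "perm_avg A f =
    (\<Sum>a\<in>A. \<Sum>b\<in>A - {a}. perm_avg (A - {a, b}) (\<lambda>xs. f (a # xs @ [b])))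
      / (real (card A) * (real (card A) - 1))"
proof -
  have fin: "finite A" using assms by (metis card.infinite not_numeral_le_zero)
  have "perm_avg A f = (\<Sum>a\<in>A. perm_avg (A - {a}) (\<lambda>xs. f (a # xs))) / card A"
    using assms fin by (intro perm_avg_Cons) auto
  also have "(\<Sum>a\<in>A. perm_avg (A - {a}) (\<lambda>xs. f (a # xs))) =
      (\<Sum>a\<in>A. (\<Sum>b\<in>A - {a}. perm_avg (A - {a, b}) (\<lambda>xs. f (a # xs @ [b])))
         / (real (card A) - 1))"
  proof (rule sum.cong[OF refl])
    fix a assume a: "a \<in> A"
    have c: "card (A - {a}) = card A - 1" using a fin by simp
    have ne: "A - {a} \<noteq> {}"
      using c assms by (metis One_nat_def card.empty diff_is_0_eq not_less_eq_eq numeral_2_eq_2)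
    have d: "A - {a} - {b} = A - {a, b}" for b by auto
    show "perm_avg (A - {a}) (\<lambda>xs. f (a # xs)) =
        (\<Sum>b\<in>A - {a}. perm_avg (A - {a, b}) (\<lambda>xs. f (a # xs @ [b]))) / (real (card A) - 1)"
      using perm_avg_snoc[of "A - {a}" "\<lambda>xs. f (a # xs)"] fin ne assms
      by (simp add: c d)
  qed
  finally show ?thesis by (simp add: sum_divide_distrib[symmetric])
qed

text \<open>Partitioning a uniform permutation by \<open>P\<close> yields two independent uniform
  permutations, and filtering keeps the first. Hence the recursive calls again have uniformly random
  inputs.\<close>

lemma perm_avg_filter:
  assumes "finite A"
  shows "perm_avg A (\<lambda>xs. f (filter P xs)) = perm_avg {x \<in> A. P x} f"
proof -
  have "map_pmf (filter P) (pmf_of_set (permutations_of_set A))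
      = map_pmf fst (map_pmf (partition P) (pmf_of_set (permutations_of_set A)))"
    by (simp add: pmf.map_comp o_def)
  also have "\<dots> = pmf_of_set (permutations_of_set {x \<in> A. P x})"
    by (simp only: partition_random_permutations[OF assms] map_fst_pair_pmf)
  finally have "map_pmf (filter P) (pmf_of_set (permutations_of_set A))
    = pmf_of_set (permutations_of_set {x \<in> A. P x})" .
  from arg_cong[OF this, of "\<lambda>M. measure_pmf.expectation M f"]
  show ?thesis using assms by (simp add: perm_avg_eq_expectation)
qed

section \<open>Expected number of wrong first comparisons\<close>

text \<open>
  \<open>diag_visits s l\<close> is the expected number of diagonal points on a uniformly random lattice path
  from the origin to \<open>(s, l)\<close>, both ends included; the \<open>k\<close>-th summand is the probability that
  the path passes through \<open>(k, k)\<close>.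
\<close>

definition diag_visits :: "nat \<Rightarrow> nat \<Rightarrow> real" where
  "diag_visits s l =
     (\<Sum>k\<le>(s + l) div 2. real (s choose k) * real (l choose k) / real ((s + l) choose (2 * k)))"

text \<open>
  A miss is an extra comparison of a small or large element. Let \<open>d\<close> be the number of small
  minus the number of large elements still to be classified. A miss is a step of \<open>d\<close> towards \<open>0\<close>
  in reversed time, except for the steps from \<open>-1\<close> to \<open>0\<close>. Such a path has
  \<open>min s l\<close> steps towards \<open>0\<close>, and by symmetry half of the returns to \<open>0\<close> come from \<open>-1\<close>.
\<close>

definition expected_misses :: "nat \<Rightarrow> nat \<Rightarrow> real" where
  "expected_misses s l = real (min s l) - (diag_visits s l - 1) / 2"

section \<open>Recurrences for diagonal visits and misses\<close>

lemma minus_times_choose: "real (n - k) * real (n choose k) = real n * real ((n - 1) choose k)"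
proof (cases "k < n")
  case True
  then show ?thesis
    using binomial_absorb_comp[of n k] by (metis of_nat_mult)
next
  case False
  then show ?thesis by (cases n) (auto simp: binomial_eq_0)
qed

text \<open>Conditioning on the last step of the path: it comes from \<open>(s - 1, l)\<close> with
  probability \<open>s / (s + l)\<close> and otherwise from \<open>(s, l - 1)\<close>; the endpoint
  itself is a visit iff \<open>s = l\<close>.\<close>

lemma diag_visits_step:
  assumes "s + l > 0"
  shows "real (s + l) * diag_visits s l =
    real (s + l) * of_bool (s = l)
    + real s * diag_visits (s - 1) l + real l * diag_visits s (l - 1)"
proof -
  define t where "t s l k = real (s choose k) * real (l choose k) / real ((s + l) choose (2 * k))"
    for s l k :: nat
  \<comment> \<open>Summands with \<open>2 * k > s' + l'\<close> are zero, so all three sums can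
    share one range.\<close>
  have ext: "diag_visits s' l' = (\<Sum>k\<le>(s + l) div 2. t s' l' k)" if "s' + l' \<le> s + l" for s' l'
    unfolding diag_visits_def t_def using that
    by (intro sum.mono_neutral_left) (auto simp: div_le_mono binomial_eq_0)
  \<comment> \<open>The endpoint visit is assigned to the index with \<open>2 * k = s + l\<close>,
    where the two predecessor terms contribute nothing.\<close>
  have step: "real (s + l) * t s l k = (if 2 * k = s + l then real (s + l) * of_bool (s = l) else 0)
      + real s * t (s - 1) l k + real l * t s (l - 1) k" if "2 * k \<le> s + l" for k
  proof (cases "2 * k = s + l")
    case True
    have "t (s - 1) l k = 0" if "s > 0"
      using True that by (simp add: t_def binomial_eq_0)
    moreover have "t s (l - 1) k = 0" if "l > 0"
      using True that by (simp add: t_def binomial_eq_0)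
    moreover have "t s l k = of_bool (s = l)"
    proof (cases "s = l")
      case False
      then have "s < k \<or> l < k" using True by linarith
      then show ?thesis using False by (auto simp: t_def binomial_eq_0)
    next
      case eq: True
      have "k = l" using eq True by simp
      show ?thesis unfolding t_def eq \<open>k = l\<close> by (simp add: mult_2)
    qed
    ultimately show ?thesis using True by (cases "s > 0"; cases "l > 0") auto
  next
    case False
    then have lt: "2 * k < s + l" using that by simp
    define D where "D = real ((s + l - 1) choose (2 * k))"
    have D: "D > 0" using lt by (simp add: D_def)
    have ts: "real s * t (s - 1) l k = real (s - k) * real (s choose k) * real (l choose k) / D"
      using minus_times_choose[of s k]
      by (cases s) (auto simp: t_def D_def)
    have tl: "real l * t s (l - 1) k = real (s choose k) * (real (l - k) * real (l choose k)) / D"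
      unfolding minus_times_choose[of l k]
      by (cases l) (auto simp: t_def D_def)
    have D': "real ((s + l) choose (2 * k)) = real (s + l) * D / real (s + l - 2 * k)"
      using minus_times_choose[of "s + l" "2 * k"] lt unfolding D_def by (simp add: field_simps)
    have "real (s + l) * t s l k = real (s + l - 2 * k) * (real (s choose k) * real (l choose k)) / D"
      unfolding t_def D' using D lt assms by (simp add: field_simps del: of_nat_add)
    \<comment> \<open>The factor splits as \<open>(s - k) + (l - k)\<close>, and absorption turns
      the parts into the two predecessor terms; if \<open>k\<close> exceeds \<open>s\<close> or
      \<open>l\<close>, a binomial factor is zero.\<close>
    also have "\<dots> = real s * t (s - 1) l k + real l * t s (l - 1) k"
    proof (cases "k \<le> s \<and> k \<le> l")
      case True
      then have "real (s + l - 2 * k) = real (s - k) + real (l - k)" by simp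
      then show ?thesis unfolding ts tl by (simp add: algebra_simps add_divide_distrib)
    next
      case False
      then have "real (s choose k) * real (l choose k) = 0" by (auto simp: binomial_eq_0)
      then show ?thesis unfolding ts tl by (auto simp: binomial_eq_0)
    qed
    finally show ?thesis using False by simp
  qed
  have "real (s + l) * diag_visits s l = (\<Sum>k\<le>(s + l) div 2. real (s + l) * t s l k)"
    by (simp add: ext sum_distrib_left)
  also have "\<dots> = (\<Sum>k\<le>(s + l) div 2. (if 2 * k = s + l then real (s + l) * of_bool (s = l) else 0)
      + real s * t (s - 1) l k + real l * t s (l - 1) k)"
    by (intro sum.cong refl step) auto
  also have "\<dots> = (\<Sum>k\<le>(s + l) div 2. if 2 * k = s + l then real (s + l) * of_bool (s = l) else 0)
      + real s * diag_visits (s - 1) l + real l * diag_visits s (l - 1)"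
    by (simp add: ext sum.distrib sum_distrib_left)
  also have "(\<Sum>k\<le>(s + l) div 2. if 2 * k = s + l then real (s + l) * of_bool (s = l) else 0)
      = real (s + l) * of_bool (s = l)"
  proof (cases "s = l")
    case True
    have "(2 * k = l + l) = (k = l)" for k by auto
    then show ?thesis using True by simp
  next
    case False
    then show ?thesis by (subst sum.neutral) auto
  qed
  finally show ?thesis .
qed

text \<open>This is conditioning on the first small or large element: a small one is a miss iff the
  larger pivot is tried first, that is \<open>s < l\<close>, and a large one iff
  \<open>l \<le> s\<close>.\<close>

lemma expected_misses_step:
  assumes "s + l > 0"
  shows "real (s + l) * expected_misses s l =
    real s * (of_bool (s < l) + expected_misses (s - 1) l)
    + real l * (of_bool (l \<le> s) + expected_misses s (l - 1))"
proof -
  have "real s * (of_bool (s < l) + expected_misses (s - 1) l)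
    + real l * (of_bool (l \<le> s) + expected_misses s (l - 1))
    = real s * (of_bool (s < l) + real (min (s - 1) l))
      + real l * (of_bool (l \<le> s) + real (min s (l - 1)))
      + real (s + l) / 2 
      - (real s * diag_visits (s - 1) l + real l * diag_visits s (l - 1)) / 2"
    by (simp add: expected_misses_def algebra_simps add_divide_distrib diff_divide_distrib)
  \<comment> \<open>The minimum alone satisfies the recurrence except on the diagonal, where it is
    off by \<open>1 / 2\<close>; half of the endpoint visit in \<open>diag_visits_step\<close> makes
    up for that.\<close>
  also have "real s * (of_bool (s < l) + real (min (s - 1) l))
      + real l * (of_bool (l \<le> s) + real (min s (l - 1)))
      = real (s + l) * (real (min s l) - of_bool (s = l) / 2)"
  proof (cases s l rule: linorder_cases)
    case less
    then have "min (s - 1) l = s - 1" "min s (l - 1) = s" by auto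
    with less show ?thesis by (cases s) (auto simp: algebra_simps)
  next
    case equal
    then show ?thesis by (cases l) (auto simp: field_simps)
  next
    case greater
    then have "min (s - 1) l = l" "min s (l - 1) = l - 1" by auto
    with greater show ?thesis by (cases l) (auto simp: algebra_simps)
  qed
  also have "real s * diag_visits (s - 1) l + real l * diag_visits s (l - 1) =
      real (s + l) * diag_visits s l - real (s + l) * of_bool (s = l)"
    using diag_visits_step[OF assms] by simp
  finally show ?thesis
    by (simp add: expected_misses_def algebra_simps add_divide_distrib diff_divide_distrib)
qed

lemma expected_misses_0 [simp]: "expected_misses 0 0 = 0"
  by (simp add: expected_misses_def diag_visits_def)

text \<open>Writing the oracle values as \<open>i + s B\<close> and \<open>j + l B\<close> makes the
  claim inductive: classifying a small or large element moves one unit from a remaining count to its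
  counter, and the decision depends only on the remaining counts.\<close>

lemma perm_avg_classification_cost:
  fixes p q :: "'a::linorder"
  assumes "finite B" "p < q" "p \<notin> B" "q \<notin> B"
  defines "s \<equiv> \<lambda>B. card {x \<in> B. x < p}" and "l \<equiv> \<lambda>B. card {x \<in> B. x > q}"
    and "m \<equiv> \<lambda>B. card {x \<in> B. p < x \<and> x < q}"
  shows "perm_avg B (\<lambda>ys. real (classification_cost (clairvoyant (i + s B) (j + l B)) p q i j ys))
    = real (card B) + real (m B) + expected_misses (s B) (l B)"
  using assms(1,3,4)
proof (induction "card B" arbitrary: B i j)
  case 0
  then show ?case by (simp add: perm_avg_def s_def l_def m_def)
next
  case (Suc n)
  let ?f = "\<lambda>i j xs. real (classification_cost (clairvoyant (i + s B) (j + l B)) p q i j xs)"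
  define S where "S = {x \<in> B. x < p}"
  define L where "L = {x \<in> B. x > q}"
  define M where "M = {x \<in> B. p < x \<and> x < q}"
  have fin: "finite S" "finite L" "finite M" using Suc.prems by (auto simp: S_def L_def M_def)
  have "x < p \<or> q < x \<or> (p < x \<and> x < q)" if "x \<in> B" for x
    using that Suc.prems by (metis linorder_neqE)
  then have un: "B = S \<union> L \<union> M" by (auto simp: S_def L_def M_def)
  have disj: "S \<inter> L = {}" "(S \<union> L) \<inter> M = {}" using assms(2) by (auto simp: S_def L_def M_def)
  have cards: "card S = s B" "card L = l B" "card M = m B" 
    by (simp_all add: S_def L_def M_def s_def l_def m_def)
  have cB: "card B = s B + l B + m B"
    using card_Un_disjoint[of S L] card_Un_disjoint[of "S \<union> L" M] fin disj
    by (simp add: cards flip: un)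
  have ne: "B \<noteq> {}" using Suc.hyps by auto
  have cl: "clairvoyant (i + s B) (j + l B) i j \<longleftrightarrow> l B \<le> s B"
    by (auto simp: clairvoyant_def)
  have IH: "perm_avg (B - {x}) (\<lambda>ys. real (classification_cost
        (clairvoyant (i' + s (B - {x})) (j' + l (B - {x}))) p q i' j' ys))
      = real n + real (m (B - {x})) + expected_misses (s (B - {x})) (l (B - {x}))"
    if "x \<in> B" for x i' j'
    using Suc.hyps(1)[of "B - {x}" i' j'] Suc.hyps(2) Suc.prems that by simp
  have S: "perm_avg (B - {x}) (\<lambda>xs. ?f i j (x # xs))
      = 1 + of_bool (s B < l B) + real n + real (m B) + expected_misses (s B - 1) (l B)" 
    if "x \<in> S" for x
  proof -
    have x: "x \<in> B" "x < p" "\<not> q < x" using that assms(2) by (auto simp: S_def)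
    have sx: "s (B - {x}) = s B - 1"
    proof -
      have "{y \<in> B - {x}. y < p} = S - {x}" by (auto simp: S_def)
      then show ?thesis using that fin by (simp add: s_def S_def[symmetric])
    qed
    have lx: "l (B - {x}) = l B" "m (B - {x}) = m B"
      unfolding l_def m_def using x by (auto intro!: arg_cong[where f = card])
    have "s B > 0" using that fin cards by (metis card_gt_0_iff empty_iff)
    then have "i + s B = Suc i + s (B - {x})" using sx by simp
    then show ?thesis using IH[OF x(1), of "Suc i" j] x Suc.prems
      by (simp add: perm_avg_add perm_avg_const cl sx lx)
  qed
  have L: "perm_avg (B - {x}) (\<lambda>xs. ?f i j (x # xs))
      = 1 + of_bool (l B \<le> s B) + real n + real (m B) + expected_misses (s B) (l B - 1)" 
    if "x \<in> L" for x
  proof -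
    have x: "x \<in> B" "\<not> x < p" "q < x" using that assms(2) by (auto simp: L_def)
    have sx: "l (B - {x}) = l B - 1"
    proof -
      have "{y \<in> B - {x}. y > q} = L - {x}" by (auto simp: L_def)
      then show ?thesis using that fin by (simp add: l_def L_def[symmetric])
    qed
    have lx: "s (B - {x}) = s B" "m (B - {x}) = m B"
      unfolding s_def m_def using x by (auto intro!: arg_cong[where f = card])
    have "l B > 0" using that fin cards by (metis card_gt_0_iff empty_iff)
    then have "j + l B = Suc j + l (B - {x})" using sx by simp
    then show ?thesis using IH[OF x(1), of i "Suc j"] x Suc.prems
      by (simp add: perm_avg_add perm_avg_const cl sx lx)
  qed
  have M: "perm_avg (B - {x}) (\<lambda>xs. ?f i j (x # xs))
      = 2 + real n + (real (m B) - 1) + expected_misses (s B) (l B)" 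
    if "x \<in> M" for x
  proof -
    have x: "x \<in> B" "\<not> x < p" "\<not> q < x" using that assms(2) by (auto simp: M_def)
    have mpos: "m B > 0" using that fin cards by (metis card_gt_0_iff empty_iff)
    have sx: "m (B - {x}) = m B - 1"
    proof -
      have "{y \<in> B - {x}. p < y \<and> y < q} = M - {x}" by (auto simp: M_def)
      then show ?thesis using that fin by (simp add: m_def M_def[symmetric])
    qed
    have lx: "s (B - {x}) = s B" "l (B - {x}) = l B"
      unfolding s_def l_def using x by (auto intro!: arg_cong[where f = card])
    show ?thesis using IH[OF x(1), of i j] x Suc.prems mpos
      by (simp add: perm_avg_add perm_avg_const cl sx lx)
  qed
  have "real (card B) * perm_avg B (?f i j) = (\<Sum>x\<in>B. perm_avg (B - {x}) (\<lambda>xs. ?f i j (x # xs)))"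
    using perm_avg_Cons[OF Suc.prems(1) ne, of "?f i j"] Suc.hyps(2) by simp
  also have "\<dots> = (\<Sum>x\<in>S. perm_avg (B - {x}) (\<lambda>xs. ?f i j (x # xs)))
      + (\<Sum>x\<in>L. perm_avg (B - {x}) (\<lambda>xs. ?f i j (x # xs)))
      + (\<Sum>x\<in>M. perm_avg (B - {x}) (\<lambda>xs. ?f i j (x # xs)))"
  proof -
    have "sum g B = sum g S + sum g L + sum g M" for g :: "'a \<Rightarrow> real"
      unfolding un using fin disj by (simp add: sum.union_disjoint)
    then show ?thesis .
  qed
  also have "\<dots> =
      real (s B) * (1 + of_bool (s B < l B) + real n + real (m B) + expected_misses (s B - 1) (l B))
      + real (l B) * (1 + of_bool (l B \<le> s B) + real n + real (m B) + expected_misses (s B) (l B - 1))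
      + real (m B) * (2 + real n + (real (m B) - 1) + expected_misses (s B) (l B))"
    by (simp only: sum.cong[OF refl S] sum.cong[OF refl L] sum.cong[OF refl M] sum_constant cards)
  also have "\<dots> = real (card B) * (1 + real n + real (m B))
      + (real (s B) * (of_bool (s B < l B) + expected_misses (s B - 1) (l B))
        + real (l B) * (of_bool (l B \<le> s B) + expected_misses (s B) (l B - 1)))
      + real (m B) * expected_misses (s B) (l B)"
    unfolding cB by (simp add: algebra_simps)
  \<comment> \<open>The small and large cases merge into \<open>expected_misses\<close> with weight
    \<open>s B + l B\<close>; medium elements leave both counts unchanged and add weight
    \<open>m B\<close>, which makes \<open>card B\<close> in total.\<close>
  also have "real (s B) * (of_bool (s B < l B) + expected_misses (s B - 1) (l B))
        + real (l B) * (of_bool (l B \<le> s B) + expected_misses (s B) (l B - 1))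
      = real (s B + l B) * expected_misses (s B) (l B)"
    using expected_misses_step[of "s B" "l B"] by (cases "s B + l B > 0") auto
  also have "real (card B) * (1 + real n + real (m B)) + \<dots> + real (m B) * expected_misses (s B) (l B)
      = real (card B) * (real (card B) + real (m B) + expected_misses (s B) (l B))"
  proof -
    have "real n = real (card B) - 1" using Suc.hyps(2) by simp
    then show ?thesis unfolding cB by (simp add: algebra_simps)
  qed
  finally show ?case using Suc.hyps(2) by simp
qed

section \<open>The quicksort recurrence\<close>

text \<open>The summand depends on the pivots only through their ranks, so an increasing enumeration
  \<open>e\<close> replaces \<open>A\<close> by \<open>{..<n}\<close>. The factor 2 counts the two
  orders of a pair of pivots.\<close>

lemma sum_pairs_by_rank:
  fixes A :: "'a::wellorder set" and h :: "nat \<Rightarrow> nat \<Rightarrow> nat \<Rightarrow> real"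
  assumes "card A \<ge> 2"
  defines "G \<equiv> \<lambda>p q. h (card {x \<in> A. x < p}) (card {x \<in> A. p < x \<and> x < q}) (card {x \<in> A. x > q})"
  shows "(\<Sum>a\<in>A. \<Sum>b\<in>A - {a}. G (min a b) (max a b))
    = 2 * (\<Sum>(s, l)\<in>{(s, l). s + l \<le> card A - 2}. h s (card A - 2 - (s + l)) l)"
proof -
  define n where "n = card A"
  have fin: "finite A" using assms(1) by (metis card.infinite not_numeral_le_zero)
  obtain e where e: "bij_betw e {..<n} A" "strict_mono_on {..<n} e"
    using ex_bij_betw_strict_mono_card[OF fin] n_def by blast
  have lt: "e i < e j \<longleftrightarrow> i < j" if "i < n" "j < n" for i j
    using strict_mono_on_less[OF e(2)] that by simp
  have A: "A = e ` {..<n}" using e(1) by (simp add: bij_betw_def)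
  have inj: "inj_on e {..<n}" using e(1) by (simp add: bij_betw_def)
  have card_e: "card (e ` X) = card X" if "X \<subseteq> {..<n}" for X
    using inj that by (metis card_image inj_on_subset)
  have below: "card {x \<in> A. x < e i} = i" if "i < n" for i
  proof -
    have "{x \<in> A. x < e i} = e ` {..<i}" using that lt by (auto simp: A)
    then show ?thesis using that by (simp add: card_e)
  qed
  have above: "card {x \<in> A. x > e i} = n - 1 - i" if "i < n" for i
  proof -
    have "{x \<in> A. x > e i} = e ` {i<..<n}" using that lt by (auto simp: A)
    then show ?thesis using that by (subst \<open>{x \<in> A. x > e i} = _\<close>, subst card_e) auto
  qed
  have between: "card {x \<in> A. e i < x \<and> x < e j} = j - i - 1" if "i < n" "j < n" for i j
  proof -
    have "{x \<in> A. e i < x \<and> x < e j} = e ` {i<..<j}" using that lt by (auto simp: A)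
    then show ?thesis using that by (subst \<open>{x \<in> A. e i < x \<and> x < e j} = _\<close>, subst card_e) auto
  qed
  have "(\<Sum>a\<in>A. \<Sum>b\<in>A - {a}. G (min a b) (max a b)) =
      (\<Sum>(a, b)\<in>(SIGMA a:A. A - {a}). G (min a b) (max a b))"
    using fin by (simp add: sum.Sigma)
  also have "(SIGMA a:A. A - {a}) = {(a, b) \<in> A \<times> A. a < b} \<union> {(a, b) \<in> A \<times> A. b < a}"
    by (auto simp: neq_iff)
  also have "(\<Sum>(a, b)\<in>\<dots>. G (min a b) (max a b)) =
      (\<Sum>(a, b)\<in>{(a, b) \<in> A \<times> A. a < b}. G (min a b) (max a b))
      + (\<Sum>(a, b)\<in>{(a, b) \<in> A \<times> A. b < a}. G (min a b) (max a b))"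
    using fin by (intro sum.union_disjoint) (auto intro: finite_subset[of _ "A \<times> A"])
  also have "(\<Sum>(a, b)\<in>{(a, b) \<in> A \<times> A. b < a}. G (min a b) (max a b))
      = (\<Sum>(a, b)\<in>{(a, b) \<in> A \<times> A. a < b}. G (min a b) (max a b))"
    by (rule sum.reindex_bij_witness[where i = prod.swap and j = prod.swap])
       (auto simp: min.commute max.commute)
  also have "(\<Sum>(a, b)\<in>{(a, b) \<in> A \<times> A. a < b}. G (min a b) (max a b))
      = (\<Sum>(i, j)\<in>{(i, j). i < j \<and> j < n}. h i (j - i - 1) (n - 1 - j))"
  proof (rule sum.reindex_bij_betw[symmetric, THEN trans, OF _ sum.cong])
    show "bij_betw (map_prod e e) {(i, j). i < j \<and> j < n} {(a, b) \<in> A \<times> A. a < b}"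
      unfolding bij_betw_def
    proof
      show "inj_on (map_prod e e) {(i, j). i < j \<and> j < n}"
        using inj by (auto simp: inj_on_def)
      show "map_prod e e ` {(i, j). i < j \<and> j < n} = {(a, b) \<in> A \<times> A. a < b}"
        using lt by (force simp: A image_def)
    qed
    fix x assume "x \<in> {(i, j). i < j \<and> j < n}"
    then obtain i j where x: "x = (i, j)" "i < j" "j < n" by auto
    have "min (e i) (e j) = e i" "max (e i) (e j) = e j" using x lt[of i j] by auto
    with x(2,3) show "(case map_prod e e x of (a, b) \<Rightarrow> G (min a b) (max a b))
        = (case x of (i, j) \<Rightarrow> h i (j - i - 1) (n - 1 - j))"
      by (simp add: x(1) G_def below above between del: min_less_iff_conj max_less_iff_conj)
  qed auto
  \<comment> \<open>Pivots of ranks \<open>i < j\<close>, counted from 0, leave \<open>i\<close>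
    small and \<open>n - 1 - j\<close> large elements.\<close>
  also have "\<dots> = (\<Sum>(s, l)\<in>{(s, l). s + l \<le> n - 2}. h s (n - 2 - (s + l)) l)"
    using assms(1)
    by (intro sum.reindex_bij_witness[where i = "\<lambda>(s, l). (s, n - 1 - l)" and j = "\<lambda>(i, j). (i, n - 1 - j)"])
       (auto simp: n_def intro!: arg_cong3[where f = h])
  finally show ?thesis by (simp add: n_def)
qed

text \<open>Given the pivots, linearity lets the classification and the three calls be averaged
  separately. With \<open>c\<close> arbitrary, the step can serve in the proof that averages depend
  on cardinality only. The part \<open>card A - 1\<close> is the comparison of the pivots plus one
  for each other element.\<close>

lemma perm_avg_cv_step:
  fixes A :: "'a::wellorder set"
  assumes n: "card A \<ge> 2"
    and IH: "\<And>B. B \<subseteq> A \<Longrightarrow> card B < card A \<Longrightarrow> perm_avg B (\<lambda>xs. real (cv_comparisons xs)) = c (card B)"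
  shows "perm_avg A (\<lambda>xs. real (cv_comparisons xs)) =
    2 * (\<Sum>(s, l)\<in>{(s, l). s + l \<le> card A - 2}.
         real (card A) - 1 + real (card A - 2 - (s + l)) + expected_misses s l
         + c s + c (card A - 2 - (s + l)) + c l)
      / (real (card A) * (real (card A) - 1))"
proof -
  have fin: "finite A" using n by (metis card.infinite not_numeral_le_zero)
  define h where "h s m l = real (card A) - 1 + real m + expected_misses s l + c s + c m + c l"
    for s m l
  define G where "G p q = h (card {x \<in> A. x < p}) (card {x \<in> A. p < x \<and> x < q}) (card {x \<in> A. x > q})"
    for p q
  have main: "perm_avg (A - {a, b}) (\<lambda>xs. real (cv_comparisons (a # xs @ [b]))) = G (min a b) (max a b)"
    if ab: "a \<in> A" "b \<in> A - {a}" for a b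
  proof -
    define B where "B = A - {a, b}"
    define p where "p = min a b"
    define q where "q = max a b"
    have pq: "p < q" "p \<notin> B" "q \<notin> B" "finite B"
      using ab fin by (auto simp: p_def q_def B_def min_def max_def)
    have "card {a, b} = 2" using ab by auto
    then have cB: "card B = card A - 2" using ab fin by (simp add: B_def card_Diff_subset)
    define S where "S = {x \<in> A. x < p}"
    define M where "M = {x \<in> A. p < x \<and> x < q}"
    define L where "L = {x \<in> A. x > q}"
    have B: "{x \<in> B. x < p} = S" "{x \<in> B. p < x \<and> x < q} = M" "{x \<in> B. x > q} = L"
      by (auto simp: S_def M_def L_def B_def p_def q_def min_def max_def split: if_splits)
    have sub: "S \<subseteq> A" "M \<subseteq> A" "L \<subseteq> A" by (auto simp: S_def M_def L_def)
    have less: "card X < card A" if "X \<subseteq> B" for X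
      using card_mono[OF pq(4) that] cB n by linarith
    have cards: "card S < card A" "card M < card A" "card L < card A"
      by (intro less; auto simp flip: B)+
    let ?cv = "\<lambda>xs. real (cv_comparisons xs)"
    have eq: "?cv (a # xs @ [b]) =
        1 + real (classification_cost (clairvoyant (0 + card S) (0 + card L)) p q 0 0 xs)
        + ?cv (filter (\<lambda>x. x < p) xs) + ?cv (filter (\<lambda>x. p < x \<and> x < q) xs)
        + ?cv (filter (\<lambda>x. x > q) xs)"
      if xs: "xs \<in> permutations_of_set B" for xs
    proof -
      have "distinct xs" "set xs = B" using xs by (auto simp: permutations_of_set_def)
      then have "length (filter P xs) = card {x \<in> B. P x}" for P
        by (metis distinct_card distinct_filter set_filter)
      then show ?thesis
        by (subst cv_comparisons.simps) (simp add: Let_def B flip: p_def q_def)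
    qed
    have "perm_avg B (\<lambda>xs. ?cv (a # xs @ [b])) =
        1 + (real (card B) + real (card M) + expected_misses (card S) (card L))
        + perm_avg S ?cv + perm_avg M ?cv + perm_avg L ?cv"
      using perm_avg_classification_cost[OF pq(4,1-3), of 0 0]
        perm_avg_filter[OF pq(4), where f = ?cv]
      by (simp add: perm_avg_cong[OF eq] perm_avg_add perm_avg_const pq(4) B)
    also have "\<dots> = h (card S) (card M) (card L)"
      using n by (simp add: h_def IH sub cards cB)
    finally show ?thesis by (simp add: G_def B_def S_def M_def L_def p_def q_def)
  qed
  have "perm_avg A (\<lambda>xs. real (cv_comparisons xs)) =
      (\<Sum>a\<in>A. \<Sum>b\<in>A - {a}. G (min a b) (max a b)) / (real (card A) * (real (card A) - 1))"
    by (subst perm_avg_ends[OF n]) (simp add: main)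
  also have "(\<Sum>a\<in>A. \<Sum>b\<in>A - {a}. G (min a b) (max a b))
    = 2 * (\<Sum>(s, l)\<in>{(s, l). s + l \<le> card A - 2}. h s (card A - 2 - (s + l)) l)"
    unfolding G_def by (rule sum_pairs_by_rank[OF n])
  finally show ?thesis by (simp add: h_def)
qed

section \<open>Independence of the underlying set\<close>

lemma perm_avg_cv_small:
  assumes "card A < 2"
  shows "perm_avg A (\<lambda>xs. real (cv_comparisons xs)) = 0"
proof -
  have "cv_comparisons xs = 0" if "xs \<in> permutations_of_set A" for xs
  proof -
    have "length xs = card A" using that by (rule length_finite_permutations_of_set)
    then show ?thesis using assms by (subst cv_comparisons.simps) simp
  qed
  then show ?thesis by (simp add: perm_avg_def)
qed

definition avg_cv :: "nat \<Rightarrow> real" where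
  "avg_cv n = perm_avg {..<n} (\<lambda>xs. real (cv_comparisons xs))"

text \<open>Strong induction: \<open>perm_avg_cv_step\<close> applies to \<open>A\<close> and to
  \<open>{..<card A}\<close> alike, with a right-hand side that depends on the cardinality
  only.\<close>

lemma perm_avg_cv_comparisons:
  fixes A :: "nat set"
  assumes "finite A"
  shows "perm_avg A (\<lambda>xs. real (cv_comparisons xs)) = avg_cv (card A)"
  using assms
proof (induction "card A" arbitrary: A rule: less_induct)
  case less
  show ?case
  proof (cases "card A < 2")
    case True
    then show ?thesis by (simp add: avg_cv_def perm_avg_cv_small)
  next
    case False
    have IH: "perm_avg B (\<lambda>xs. real (cv_comparisons xs)) = avg_cv (card B)"
      if "B \<subseteq> X" "finite X" "card B < card A" for B X :: "nat set"
      using less.hyps[of B] that finite_subset by blast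
    show ?thesis
      unfolding avg_cv_def
      using False less.prems perm_avg_cv_step[of A avg_cv] perm_avg_cv_step[of "{..<card A}" avg_cv] 
        IH by (simp add: finite_subset)
  qed
qed

lemma expected_cv_comparisons_eq: "expected_cv_comparisons n = avg_cv n"
  using perm_avg_cv_comparisons[of "{1..n}"]
  by (simp add: expected_cv_comparisons_def perm_avg_eq_expectation)

lemma avg_cv_less_2: "n < 2 \<Longrightarrow> avg_cv n = 0"
  by (simp add: avg_cv_def perm_avg_cv_small)

text \<open>The factor on the left is the number of unordered pairs of pivots; the shift by 2
  removes the subtraction \<open>card A - 2\<close>.\<close>

lemma avg_cv_rec:
  "real (n + 1) * real (n + 2) / 2 * avg_cv (n + 2) =
    (\<Sum>(s, l)\<in>{(s, l). s + l \<le> n}.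
         real (n + 1) + real (n - (s + l)) + expected_misses s l
         + avg_cv s + avg_cv (n - (s + l)) + avg_cv l)" (is "_ = ?X")
proof -
  have "avg_cv (n + 2) = 2 * ?X / (real (n + 2) * real (n + 1))"
    using perm_avg_cv_step[of "{..<n + 2}" avg_cv]
      perm_avg_cv_comparisons[OF finite_subset[OF _ finite_lessThan]]
      perm_avg_cv_comparisons[of "{..<n + 2}"]
    by (simp add: algebra_simps)
  moreover have "u * v / 2 * (2 * X / (v * u)) = X" if "u > 0" "v > 0" for u v X :: real
    using that by simp
  ultimately show ?thesis by simp
qed

section \<open>Summation\<close>

text \<open>Counts subsets of \<open>{0..N}\<close> of size \<open>a + b + 1\<close> by the element
  \<open>s\<close> that has \<open>a\<close> chosen elements below it and \<open>b\<close> above.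
  The induction uses Pascal's rule.\<close>

lemma sum_choose_mult_choose:
  "(\<Sum>s\<le>N. (s choose a) * ((N - s) choose b)) = Suc N choose (a + b + 1)"
proof (induction N arbitrary: b)
  case 0
  then show ?case by (cases a; cases b) auto
next
  case (Suc N)
  show ?case
  proof (cases b)
    case 0
    then show ?thesis using sum_choose_upper[of a "Suc N"] by simp
  next
    case (Suc b')
    have "(\<Sum>s\<le>Suc N. (s choose a) * ((Suc N - s) choose b)) =
        (\<Sum>s\<le>N. (s choose a) * (Suc (N - s) choose Suc b'))"
      using Suc by (simp add: Suc_diff_le)
    also have "\<dots> = (\<Sum>s\<le>N. (s choose a) * ((N - s) choose b'))
        + (\<Sum>s\<le>N. (s choose a) * ((N - s) choose Suc b'))"
      by (simp add: algebra_simps sum.distrib)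
    also have "\<dots> = Suc (Suc N) choose (a + b + 1)"
      using Suc by (simp only: Suc.IH) simp
    finally show ?thesis .
  qed
qed

text \<open>From \<open>N\<close> to \<open>N + 2\<close>, two zero end terms appear and every inner
  minimum grows by 1; hence the induction in steps of two.\<close>

lemma sum_min_diff: "(\<Sum>s\<le>N. real (min s (N - s))) = (2 * real N ^ 2 - 1 + (-1) ^ N) / 8"
proof (induction N rule: nat_induct2)
  case (step N)
  have "(\<Sum>s\<le>N + 2. real (min s (N + 2 - s))) = (\<Sum>s\<le>Suc N. real (min (Suc s) (N + 1 - s)))"
    using sum.atMost_Suc_shift[of "\<lambda>s. real (min s (N + 2 - s))" "Suc N"] by simp
  also have "\<dots> = (\<Sum>s\<le>N. real (min (Suc s) (N + 1 - s)))"
    by simp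
  also have "\<dots> = (\<Sum>s\<le>N. 1 + real (min s (N - s)))"
    by (intro sum.cong) auto
  also have "\<dots> = real (N + 1) + (\<Sum>s\<le>N. real (min s (N - s)))"
    by (simp add: sum.distrib)
  finally show ?case using step by (simp add: power2_eq_square field_simps)
qed auto

text \<open>In the difference of the two harmonic sums the even terms cancel and the odd terms
  double.\<close>

lemma sum_odd_reciprocals:
  "(\<Sum>k\<le>N div 2. 1 / real (2 * k + 1)) = (harm (N + 1) - alt_harm (N + 1)) / 2"
proof (induction N)
  case 0
  then show ?case by (simp add: harm_def alt_harm_def)
next
  case (Suc N)
  have h: "harm (Suc N + 1) = harm (N + 1) + 1 / real (N + 2)"
    by (simp add: harm_Suc field_simps)
  have a: "alt_harm (Suc N + 1) = alt_harm (N + 1) + (-1) ^ N / real (N + 2)"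
    by (simp add: alt_harm_def)
  show ?case
  proof (cases "even N")
    case True
    then have "Suc N div 2 = N div 2" by simp
    then show ?thesis using Suc True unfolding h a by simp
  next
    case False
    then have d: "Suc N div 2 = Suc (N div 2)" by simp
    have "2 * Suc (N div 2) + 1 = N + 2" using False by presburger
    then have "(\<Sum>k\<le>Suc N div 2. 1 / real (2 * k + 1)) = (\<Sum>k\<le>N div 2. 1 / real (2 * k + 1)) + 1 / real (N + 2)"
      unfolding d sum.atMost_Suc by presburger
    then show ?thesis unfolding Suc.IH h a using False
      by (simp add: add_divide_distrib diff_divide_distrib) (simp add: field_simps)
  qed
qed

section \<open>The closed form and its three-term recurrence\<close>

definition closed_form :: "nat \<Rightarrow> real" where
  "closed_form n =
    9 / 5 * real n * harm n + 1 / 5 * real n * alt_harm n - 89 / 25 * real n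
    + 77 / 40 * harm n + 3 / 40 * alt_harm n + 67 / 800 - (-1) ^ n / 10
    + cv_remainder n"

text \<open>The sum of \<open>expected_misses\<close> over \<open>s + l = N\<close>, see
  \<open>sum_expected_misses\<close>: the first fraction stems from the minima, the rest from the
  diagonal visits.\<close>

definition total_misses :: "nat \<Rightarrow> real" where
  "total_misses N = (2 * real N ^ 2 - 1 + (-1) ^ N) / 8
    - real (N + 1) / 4 * (harm (N + 1) - alt_harm (N + 1)) + real (N + 1) / 2"

text \<open>Settles the remainder in \<open>closed_form_rec\<close> separately. The coefficient
  \<open>(n - 1) (n + 4) / 2\<close> is \<open>(n + 1) (n + 2) / 2 - 3\<close>, the 3 coming from
  the three recursive calls.\<close>

lemma cv_remainder_rec:
  assumes "n \<ge> 2"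
  shows "real (n + 3) * real (n + 4) / 2 * cv_remainder (n + 4)
    - real (n + 2) * real (n + 3) * cv_remainder (n + 3)
    + real (n - 1) * real (n + 4) / 2 * cv_remainder (n + 2) = (-1) ^ n * (2 * real n + 7) / 80"
proof -
  define x where "x = real n - 1"
  have x: "x > 0" "real n = x + 1" "real (n - 1) = x" using assms by (auto simp: x_def)
  have nz: "x \<noteq> 0" "x + 1 \<noteq> 0" "x + 2 \<noteq> 0" "x + 3 \<noteq> 0" "x + 4 \<noteq> 0" "x + 5 \<noteq> 0"
    using x by auto
  show ?thesis
  proof (cases "even n")
    case True
    then have r: "cv_remainder (n + 2) = 1 / 320 * (1 / x + 3 / (x + 2))"
      "cv_remainder (n + 3) = - (1 / 320 * (3 / (x + 2) + 1 / (x + 4)))"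
      "cv_remainder (n + 4) = 1 / 320 * (1 / (x + 2) + 3 / (x + 4))"
      by (simp_all add: cv_remainder_def x add_ac)
    have "(x + 4) * (x + 5) / 2 * (1 / 320 * (1 / (x + 2) + 3 / (x + 4)))
      - (x + 3) * (x + 4) * (- (1 / 320 * (3 / (x + 2) + 1 / (x + 4))))
      + x * (x + 5) / 2 * (1 / 320 * (1 / x + 3 / (x + 2))) = (2 * x + 9) / 80"
      using nz by (simp add: divide_simps) (simp add: algebra_simps)
    then show ?thesis unfolding r using True by (simp add: x x(3)[simplified] add_ac)
  next
    case False
    then have r: "cv_remainder (n + 2) = - (1 / 320 * (3 / (x + 1) + 1 / (x + 3)))"
      "cv_remainder (n + 3) = 1 / 320 * (1 / (x + 1) + 3 / (x + 3))"
      "cv_remainder (n + 4) = - (1 / 320 * (3 / (x + 3) + 1 / (x + 5)))"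
      by (simp_all add: cv_remainder_def x add_ac)
    have "(x + 4) * (x + 5) / 2 * (- (1 / 320 * (3 / (x + 3) + 1 / (x + 5))))
      - (x + 3) * (x + 4) * (1 / 320 * (1 / (x + 1) + 3 / (x + 3)))
      + x * (x + 5) / 2 * (- (1 / 320 * (3 / (x + 1) + 1 / (x + 3)))) = - (2 * x + 9) / 80"
      using nz by (simp add: divide_simps) (simp add: algebra_simps)
    then show ?thesis unfolding r using False by (simp add: x x(3)[simplified] add_ac)
  qed
qed

text \<open>With all harmonic numbers reduced to index \<open>n + 2\<close>, the claim is linear in
  \<open>h\<close>, \<open>a\<close>, two reciprocals and three remainders, and the coefficients are
  compared one by one.\<close>

lemma closed_form_rec:
  assumes "n \<ge> 2"
  shows "real (n + 3) * real (n + 4) / 2 * closed_form (n + 4) =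
    real (n + 2) * real (n + 3) * closed_form (n + 3)
    - real (n + 1) * real (n + 2) / 2 * closed_form (n + 2)
    + (4 * real n + 9) + total_misses (n + 2) - total_misses (n + 1) + 3 * closed_form (n + 2)"
proof -
  define h where "h = (harm (n + 2) :: real)"
  define a where "a = alt_harm (n + 2)"
  define x where "x = real n - 1"
  have x: "x > 0" "real n = x + 1" using assms by (auto simp: x_def)
  have h3: "harm (n + 3) = h + 1 / (x + 4)"
    by (simp add: h_def x_def eval_nat_numeral inverse_eq_divide add_ac harm_Suc)
  have h4: "harm (n + 4) = h + 1 / (x + 4) + 1 / (x + 5)"
    by (simp add: h_def x_def eval_nat_numeral inverse_eq_divide add_ac harm_Suc)
  have a3: "alt_harm (n + 3) = a - (-1) ^ n / (x + 4)"
    by (simp add: alt_harm_def a_def x_def eval_nat_numeral add_ac)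
  have a4: "alt_harm (n + 4) = a - (-1) ^ n / (x + 4) + (-1) ^ n / (x + 5)"
    by (simp add: alt_harm_def a_def x_def eval_nat_numeral add_ac)
  have c2: "closed_form (n + 2) = 9 / 5 * (x + 3) * h + 1 / 5 * (x + 3) * a - 89 / 25 * (x + 3)
    + 77 / 40 * h + 3 / 40 * a + 67 / 800 - (-1) ^ n / 10 + cv_remainder (n + 2)"
    unfolding closed_form_def h_def[symmetric] a_def[symmetric] by (simp add: x add_ac)
  have c3: "closed_form (n + 3) = 9 / 5 * (x + 4) * (h + 1 / (x + 4))
    + 1 / 5 * (x + 4) * (a - (-1) ^ n / (x + 4)) - 89 / 25 * (x + 4)
    + 77 / 40 * (h + 1 / (x + 4)) + 3 / 40 * (a - (-1) ^ n / (x + 4))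
    + 67 / 800 + (-1) ^ n / 10 + cv_remainder (n + 3)"
    unfolding closed_form_def h3 a3 by (simp add: x power_add add_ac)
  have c4: "closed_form (n + 4) = 9 / 5 * (x + 5) * (h + 1 / (x + 4) + 1 / (x + 5))
    + 1 / 5 * (x + 5) * (a - (-1) ^ n / (x + 4) + (-1) ^ n / (x + 5)) - 89 / 25 * (x + 5)
    + 77 / 40 * (h + 1 / (x + 4) + 1 / (x + 5))
    + 3 / 40 * (a - (-1) ^ n / (x + 4) + (-1) ^ n / (x + 5))
    + 67 / 800 - (-1) ^ n / 10 + cv_remainder (n + 4)"
    unfolding closed_form_def h4 a4 by (simp add: x power_add add_ac)
  have m1: "total_misses (n + 1) = (2 * (x + 2)\<^sup>2 - 1 - (-1) ^ n) / 8
    - (x + 3) / 4 * (h - a) + (x + 3) / 2"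
    unfolding total_misses_def h_def a_def by (simp add: x add_ac)
  have m2: "total_misses (n + 2) = (2 * (x + 3)\<^sup>2 - 1 + (-1) ^ n) / 8
    - (x + 4) / 4 * (h + 1 / (x + 4) - (a - (-1) ^ n / (x + 4))) + (x + 4) / 2"
    using h3 a3 unfolding total_misses_def by (simp add: x add_ac numeral_3_eq_3)
  define e :: real where "e = (-1) ^ n"
  define i4 where "i4 = 1 / (x + 4)"
  define i5 where "i5 = 1 / (x + 5)"
  define r2 where "r2 = cv_remainder (n + 2)"
  define r3 where "r3 = cv_remainder (n + 3)"
  define r4 where "r4 = cv_remainder (n + 4)"
  have i: "i4 * (x + 4) = 1" "i5 * (x + 5) = 1" using x by (auto simp: i4_def i5_def)
  have e: "e / (x + 4) = e * i4" "e / (x + 5) = e * i5"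
    by (simp_all add: i4_def i5_def)
  define p3 where "p3 = x * (x + 5) / 2"
  define p4 where "p4 = (x + 3) * (x + 4)"
  define p5 where "p5 = (x + 4) * (x + 5) / 2"
  have p3: "(x + 2) * (x + 3) / 2 = p3 + 3" by (simp add: p3_def field_simps)
  have casts: "real (n + 1) = x + 2" "real (n + 2) = x + 3" "real (n + 3) = x + 4"
    "real (n + 4) = x + 5" "4 * real n + 9 = 4 * x + 13"
    by (simp_all add: x)
  have r: "p5 * r4 - p4 * r3 + p3 * r2 = e * (2 * x + 9) / 80"
    using cv_remainder_rec[OF assms] assms
    by (simp add: e_def r2_def r3_def r4_def p3_def p4_def p5_def x add_ac)
  \<comment> \<open>Coefficients of the harmonic and the alternating harmonic number, and the part
    free of both, at index \<open>x + k\<close>; the indices \<open>n + 2\<close>,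
    \<open>n + 3\<close>, \<open>n + 4\<close> are \<open>k = 3, 4, 5\<close>.\<close>
  define A where "A k = 9 / 5 * (x + k) + 77 / 40" for k
  define B where "B k = 1 / 5 * (x + k) + 3 / 40" for k
  define G where "G k = 67 / 800 - 89 / 25 * (x + k)" for k
  \<comment> \<open>\<open>q4\<close> and \<open>q5\<close> are the coefficients of
    \<open>i4\<close> and \<open>i5\<close> divided by \<open>x + 4\<close> and
    \<open>x + 5\<close>, so that the reciprocals cancel.\<close>
  define q4 where "q4 = (x + 5) / 2 * (A 5 - e * B 5) - (x + 3) * (A 4 - e * B 4) + (1 + e) / 4"
  define q5 where "q5 = (x + 4) / 2 * (A 5 + e * B 5)"
  define m1' where "m1' = (2 * (x + 2)\<^sup>2 - 1 - e) / 8 + (x + 3) / 2"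
  define m2' where "m2' = (2 * (x + 3)\<^sup>2 - 1 + e) / 8 + (x + 4) / 2"
  \<comment> \<open>\<open>1 / 4\<close> is the coefficient of \<open>h\<close> in
    \<open>total_misses (n + 1) - total_misses (n + 2)\<close>.\<close>
  have coeff_h: "p5 * A 5 - p4 * A 4 + p3 * A 3 + 1 / 4 = 0"
    by (simp add: p3_def p4_def p5_def A_def field_simps)
  have coeff_a: "p5 * B 5 - p4 * B 4 + p3 * B 3 - 1 / 4 = 0"
    by (simp add: p3_def p4_def p5_def B_def field_simps)
  have coeff_i4: "p5 * (A 5 - e * B 5) - p4 * (A 4 - e * B 4) + (x + 4) / 4 * (1 + e) = q4 * (x + 4)"
    by (simp add: p4_def p5_def q4_def field_simps)
  have coeff_i5: "p5 * (A 5 + e * B 5) = q5 * (x + 5)"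
    by (simp add: p5_def q5_def)
  have const: "p5 * (G 5 - e / 10) - p4 * (G 4 + e / 10) + p3 * (G 3 - e / 10)
      - (4 * x + 13) - m2' + m1' + e * (2 * x + 9) / 80 + q4 + q5 = 0"
    by (simp add: p3_def p4_def p5_def q4_def q5_def m1'_def m2'_def A_def B_def G_def
        field_simps power2_eq_square)
  let ?c2 = "A 3 * h + B 3 * a + G 3 - e / 10 + r2"
  let ?c3 = "A 4 * (h + i4) + B 4 * (a - e * i4) + G 4 + e / 10 + r3"
  let ?c4 = "A 5 * (h + i4 + i5) + B 5 * (a - e * i4 + e * i5) + G 5 - e / 10 + r4"
  let ?m1 = "m1' - (x + 3) / 4 * (h - a)"
  let ?m2 = "m2' - (x + 4) / 4 * (h + i4 - (a - e * i4))"
  have "p5 * ?c4 - (p4 * ?c3 - (p3 + 3) * ?c2 + (4 * x + 13) + ?m2 - ?m1 + 3 * ?c2)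
    = h * (p5 * A 5 - p4 * A 4 + p3 * A 3 + 1 / 4)
      + a * (p5 * B 5 - p4 * B 4 + p3 * B 3 - 1 / 4)
      + i4 * (p5 * (A 5 - e * B 5) - p4 * (A 4 - e * B 4) + (x + 4) / 4 * (1 + e))
      + i5 * (p5 * (A 5 + e * B 5)) + (p5 * r4 - p4 * r3 + p3 * r2)
      + (p5 * (G 5 - e / 10) - p4 * (G 4 + e / 10) + p3 * (G 3 - e / 10)
        - (4 * x + 13) - m2' + m1')"
    by (simp add: field_simps)
  also have "\<dots> = q4 * (i4 * (x + 4)) + q5 * (i5 * (x + 5)) + e * (2 * x + 9) / 80
      + (p5 * (G 5 - e / 10) - p4 * (G 4 + e / 10) + p3 * (G 3 - e / 10)
        - (4 * x + 13) - m2' + m1')"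
    unfolding coeff_h coeff_a coeff_i4 coeff_i5 r by simp
  also have "\<dots> = 0" unfolding i using const by simp
  finally have id: "p5 * ?c4 = p4 * ?c3 - (p3 + 3) * ?c2 + (4 * x + 13) + ?m2 - ?m1 + 3 * ?c2"
    by (rule eq_iff_diff_eq_0[THEN iffD2])
  have "closed_form (n + 2) = ?c2"
    unfolding c2 e_def[symmetric] r2_def[symmetric] by (simp add: A_def B_def G_def algebra_simps)
  moreover have "closed_form (n + 3) = ?c3"
    unfolding c3 e_def[symmetric] r3_def[symmetric] e i4_def[symmetric]
    by (simp add: A_def B_def G_def algebra_simps)
  moreover have "closed_form (n + 4) = ?c4"
    unfolding c4 e_def[symmetric] r4_def[symmetric] e i4_def[symmetric] i5_def[symmetric]
    by (simp add: A_def B_def G_def algebra_simps)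
  moreover have "total_misses (n + 1) = ?m1"
    unfolding m1 e_def[symmetric] m1'_def by simp
  moreover have "total_misses (n + 2) = ?m2"
    unfolding m2 e_def[symmetric] e i4_def[symmetric] m2'_def by simp
  ultimately show ?thesis
    unfolding casts p3 p4_def[symmetric] p5_def[symmetric] using id by simp
qed

section \<open>The three-term recurrence for the averages\<close>

lemma sum_diag_visits:
  "(\<Sum>s\<le>N. diag_visits s (N - s)) = real (N + 1) * (\<Sum>k\<le>N div 2. 1 / real (2 * k + 1))"
proof -
  have "(\<Sum>s\<le>N. diag_visits s (N - s)) =
      (\<Sum>s\<le>N. \<Sum>k\<le>N div 2. real ((s choose k) * ((N - s) choose k)) / real (N choose (2 * k)))"
    by (intro sum.cong) (auto simp: diag_visits_def)
  also have "\<dots> = (\<Sum>k\<le>N div 2. real (\<Sum>s\<le>N. (s choose k) * ((N - s) choose k)) / real (N choose (2 * k)))"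
    by (subst sum.swap) (simp add: sum_divide_distrib)
  also have "\<dots> = (\<Sum>k\<le>N div 2. real (N + 1) * (1 / real (2 * k + 1)))"
  \<comment> \<open>For fixed \<open>k\<close> the sum over \<open>s\<close> is
    \<open>Suc N choose Suc (2 * k)\<close>; absorption against \<open>N choose (2 * k)\<close>
    leaves \<open>(N + 1) / (2 * k + 1)\<close>.\<close>
  proof (intro sum.cong refl)
    fix k assume k: "k \<in> {..N div 2}"
    have "real (Suc (2 * k)) * real (Suc N choose Suc (2 * k)) = real (Suc N) * real (N choose (2 * k))"
      by (metis Suc_times_binomial of_nat_mult)
    moreover have "real (N choose (2 * k)) > 0"
      using k by simp
    moreover have "(\<Sum>s\<le>N. (s choose k) * ((N - s) choose k)) = Suc N choose Suc (2 * k)"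
      by (simp add: sum_choose_mult_choose mult_2)
    ultimately show "real (\<Sum>s\<le>N. (s choose k) * ((N - s) choose k)) / real (N choose (2 * k))
        = real (N + 1) * (1 / real (2 * k + 1))"
      by (simp add: field_simps del: of_nat_Suc of_nat_add binomial_Suc_Suc)
  qed
  finally show ?thesis by (simp add: sum_distrib_left)
qed

lemma sum_expected_misses: "(\<Sum>s\<le>N. expected_misses s (N - s)) = total_misses N"
proof -
  have "(\<Sum>s\<le>N. expected_misses s (N - s)) =
      (\<Sum>s\<le>N. real (min s (N - s))) - ((\<Sum>s\<le>N. diag_visits s (N - s)) - real (N + 1)) / 2"
    by (simp add: expected_misses_def sum_subtractf flip: sum_divide_distrib)
  then show ?thesis
    unfolding sum_min_diff sum_diag_visits sum_odd_reciprocals total_misses_def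
    by (simp add: algebra_simps diff_divide_distrib add_divide_distrib)
qed

text \<open>In the cost terms \<open>N\<close> stands for \<open>s + l\<close>, attained by
  \<open>N + 1\<close> pairs; in the last term it is the size of a subproblem, attained by
  \<open>n + 1 - N\<close> pairs. The 3 reflects that the three groups have equally distributed
  sizes.\<close>

lemma avg_cv_sum:
  "real (n + 1) * real (n + 2) / 2 * avg_cv (n + 2) =
    (\<Sum>N\<le>n. real (N + 1) * (2 * real n + 1 - real N) + total_misses N
      + 3 * (real n + 1 - real N) * avg_cv N)"
proof -
  have tri: "(\<Sum>(s, l)\<in>{(s, l). s + l \<le> n}. f s l) = (\<Sum>N\<le>n. \<Sum>s\<le>N. f s (N - s))"
    for f :: "nat \<Rightarrow> nat \<Rightarrow> real" by (rule sum.triangle_reindex_eq)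
  have Sig: "{(s, l). s + l \<le> n} = (SIGMA s:{..n}. {..n - s})" by auto
  have A: "(\<Sum>(s, l)\<in>{(s, l). s + l \<le> n}. avg_cv s) = (\<Sum>N\<le>n. (real n + 1 - real N) * avg_cv N)"
    unfolding Sig by (subst sum.Sigma[symmetric]) (auto intro!: sum.cong)
  have B: "(\<Sum>(s, l)\<in>{(s, l). s + l \<le> n}. avg_cv l) = (\<Sum>(s, l)\<in>{(s, l). s + l \<le> n}. avg_cv s)"
    by (rule sum.reindex_bij_witness[where i = prod.swap and j = prod.swap]) auto
  \<comment> \<open>The involution exchanges the sizes of the small and the medium group.\<close>
  have C: "(\<Sum>(s, l)\<in>{(s, l). s + l \<le> n}. avg_cv (n - (s + l)))
      = (\<Sum>(s, l)\<in>{(s, l). s + l \<le> n}. avg_cv s)"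
    by (rule sum.reindex_bij_witness[where i = "\<lambda>(m, l). (n - (m + l), l)" and j = "\<lambda>(s, l). (n - (s + l), l)"]) auto
  have D: "(\<Sum>(s, l)\<in>{(s, l). s + l \<le> n}. real (n + 1) + real (n - (s + l)) + expected_misses s l)
      = (\<Sum>N\<le>n. real (N + 1) * (2 * real n + 1 - real N) + total_misses N)"
    unfolding tri
  proof (intro sum.cong refl)
    fix N assume N: "N \<in> {..n}"
    have "(\<Sum>s\<le>N. real (n + 1) + real (n - (s + (N - s))) + expected_misses s (N - s))
        = (\<Sum>s\<le>N. (2 * real n + 1 - real N) + expected_misses s (N - s))"
      using N by (intro sum.cong) auto
    then show "(\<Sum>s\<le>N. real (n + 1) + real (n - (s + (N - s))) + expected_misses s (N - s))
        = real (N + 1) * (2 * real n + 1 - real N) + total_misses N"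
      by (simp add: sum.distrib sum_expected_misses)
  qed
  have "real (n + 1) * real (n + 2) / 2 * avg_cv (n + 2) =
      (\<Sum>(s, l)\<in>{(s, l). s + l \<le> n}. real (n + 1) + real (n - (s + l)) + expected_misses s l)
      + (\<Sum>(s, l)\<in>{(s, l). s + l \<le> n}. avg_cv s)
      + (\<Sum>(s, l)\<in>{(s, l). s + l \<le> n}. avg_cv (n - (s + l)))
      + (\<Sum>(s, l)\<in>{(s, l). s + l \<le> n}. avg_cv l)"
    unfolding avg_cv_rec by (simp only: case_prod_unfold sum.distrib)
  also have "\<dots> = (\<Sum>N\<le>n. real (N + 1) * (2 * real n + 1 - real N) + total_misses N)
      + 3 * (\<Sum>N\<le>n. (real n + 1 - real N) * avg_cv N)"
    unfolding D C B A by simp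
  finally show ?thesis by (simp only: sum.distrib sum_distrib_left mult.assoc)
qed

text \<open>The weights in \<open>avg_cv_sum\<close> are linear in \<open>n\<close>, so their
  differences are free of \<open>n\<close>; the other terms are the new summand
  \<open>N = n + 1\<close>.\<close>

lemma avg_cv_diff:
  "real (n + 2) * real (n + 3) / 2 * avg_cv (n + 3) - real (n + 1) * real (n + 2) / 2 * avg_cv (n + 2)
   = (\<Sum>N\<le>n. 2 * real (N + 1) + 3 * avg_cv N) + real (n + 2) ^ 2 + total_misses (n + 1)
     + 3 * avg_cv (n + 1)"
proof -
  let ?f = "\<lambda>n N. real (N + 1) * (2 * real n + 1 - real N) + total_misses N
      + 3 * (real n + 1 - real N) * avg_cv N"
  have idx: "n + 1 + 1 = n + 2" "n + 1 + 2 = n + 3" by auto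
  have "(\<Sum>N\<le>n + 1. ?f (n + 1) N) = (\<Sum>N\<le>n. ?f (n + 1) N)
      + (real (n + 2) ^ 2 + total_misses (n + 1) + 3 * avg_cv (n + 1))"
    by (simp add: power2_eq_square)
  also have "(\<Sum>N\<le>n. ?f (n + 1) N) = (\<Sum>N\<le>n. ?f n N + (2 * real (N + 1) + 3 * avg_cv N))"
    by (intro sum.cong refl) (simp add: algebra_simps)
  also have "\<dots> = (\<Sum>N\<le>n. ?f n N) + (\<Sum>N\<le>n. 2 * real (N + 1) + 3 * avg_cv N)"
    by (rule sum.distrib)
  finally show ?thesis
    using avg_cv_sum[of "n + 1"] avg_cv_sum[of n] unfolding idx by linarith
qed

text \<open>A second difference removes the sum. In \<open>4 * n + 9\<close>, the part
  \<open>2 * n + 4\<close> is from its last summand and \<open>2 * n + 5\<close> is the difference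
  of the squares.\<close>

lemma avg_cv_three_term:
  "real (n + 3) * real (n + 4) / 2 * avg_cv (n + 4) =
    real (n + 2) * real (n + 3) * avg_cv (n + 3)
    - real (n + 1) * real (n + 2) / 2 * avg_cv (n + 2)
    + (4 * real n + 9) + total_misses (n + 2) - total_misses (n + 1) + 3 * avg_cv (n + 2)"
proof -
  have idx: "n + 1 + 1 = n + 2" "n + 1 + 2 = n + 3" "n + 1 + 3 = n + 4" by auto
  have S: "(\<Sum>N\<le>n + 1. 2 * real (N + 1) + 3 * avg_cv N)
    = (\<Sum>N\<le>n. 2 * real (N + 1) + 3 * avg_cv N) + 2 * real n + 4 + 3 * avg_cv (n + 1)"
    by simp
  have sq: "real (n + 3) ^ 2 = real (n + 2) ^ 2 + 2 * real n + 5"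
    by (simp add: power2_eq_square algebra_simps)
  have twice: "real (n + 2) * real (n + 3) * avg_cv (n + 3)
    = 2 * (real (n + 2) * real (n + 3) / 2 * avg_cv (n + 3))" by simp
  show ?thesis
    using avg_cv_diff[of "n + 1"] avg_cv_diff[of n] unfolding idx S sq twice by linarith
qed

text \<open>\<open>closed_form_rec\<close> starts at \<open>n = 2\<close> and so links the indices
  from 4 on; the induction carries two consecutive values, beginning with 4 and 5.\<close>

lemma avg_cv_eq_closed_form:
  assumes "n \<ge> 4"
  shows "avg_cv n = closed_form n"
proof -
  have c01: "avg_cv 0 = 0" "avg_cv (Suc 0) = 0" by (auto simp: avg_cv_less_2)
  have c2: "avg_cv 2 = 1"
    using avg_cv_sum[of 0] by (simp add: total_misses_def harm_def alt_harm_def c01 numeral_2_eq_2)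
  have c3: "avg_cv 3 = 7 / 3"
    using avg_cv_sum[of 1] by (simp add: total_misses_def harm_def alt_harm_def c01 eval_nat_numeral)
  have h: "harm 2 = (3 / 2 :: real)" "harm 3 = (11 / 6 :: real)" "harm 4 = (25 / 12 :: real)"
    "harm 5 = (137 / 60 :: real)"
    by (simp_all add: harm_def eval_nat_numeral)
  have a: "alt_harm 2 = - 1 / 2" "alt_harm 3 = - 5 / 6" "alt_harm 4 = - 7 / 12"
    "alt_harm 5 = - 47 / 60"
    by (simp_all add: alt_harm_def eval_nat_numeral)
  have idx: "Suc (Suc 0) = 2" "Suc 2 = 3" by simp_all
  \<comment> \<open>The averages satisfy the three-term recurrence already from
    \<open>n = 0\<close>, which yields the two base values.\<close>
  have c4: "avg_cv 4 = closed_form 4"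
    using avg_cv_three_term[of 0] c2 c3
    by (simp add: closed_form_def cv_remainder_def total_misses_def idx h a)
  have c5: "avg_cv 5 = closed_form 5"
    using avg_cv_three_term[of 1] c3 c4
    by (simp add: closed_form_def cv_remainder_def total_misses_def idx h a)
  have "avg_cv (k + 4) = closed_form (k + 4) \<and> avg_cv (k + 5) = closed_form (k + 5)" for k
  proof (induction k)
    case (Suc k)
    have idx: "k + 2 + 4 = Suc k + 5" "k + 2 + 3 = k + 5" "k + 2 + 2 = k + 4" by auto
    have "real (k + 5) * real (Suc k + 5) / 2 * avg_cv (Suc k + 5)
        = real (k + 5) * real (Suc k + 5) / 2 * closed_form (Suc k + 5)"
      using avg_cv_three_term[of "k + 2"] closed_form_rec[of "k + 2"] Suc.IH
      unfolding idx by simp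
    then show ?case using Suc.IH by (simp add: eval_nat_numeral)
  qed (use c4 c5 in auto)
  from this[of "n - 4"] show ?thesis using assms by simp
qed

theorem theorem10p1:
  fixes n :: nat
  assumes "n \<ge> 4"
  shows "expected_cv_comparisons n =
    9 / 5 * real n * harm n + 1 / 5 * real n * alt_harm n - 89 / 25 * real n
    + 77 / 40 * harm n + 3 / 40 * alt_harm n + 67 / 800 - (-1) ^ n / 10
    + cv_remainder n"
  using assms by (simp add: expected_cv_comparisons_eq avg_cv_eq_closed_form closed_form_def)

end
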